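(* Let $T>0$. For any exotic coloured tree $\tau\in\mathcal{T}^{\mathfrak e}_{\alpha,\beta}$ and any $t\in[0,T]$, $$\Pi^{\mathfrak e}_t(\tau)=\frac{|\tau|}{\tau!}\,t^{|\tau|-1}.$$
   Context: Exotic coloured trees: an exotic coloured tree $\tau$ is a finite non-planar rooted tree with edges oriented towards the root $\rho_\tau$; the root is uncoloured; every non-root vertex has a colour in $\{\alpha,\beta\}$; the set $\mathcal V_\beta(\tau)$ of $\beta$-coloured vertices has even cardinality and is equipped with an exotic decoration $\mathfrak e$, i.e. a partition of $\mathcal V_\beta(\tau)$ into pairs ($\mathfrak e(v)=\mathfrak e(w)$ iff $v,w$ are in the same pair; labels irrelevant). Paired vertices may be anywhere in the tree. $\mathcal V_\alpha(\tau)$ is the set of $\alpha$-coloured vertices. $\mathcal{T}^{\mathfrak e}_{\alpha,\beta}$ is the set of isomorphism classes of such trees (including the single root $\bullet$). Set $|\tau|:=|\mathcal V_\alpha(\tau)|+\tfrac12|\mathcal V_\beta(\tau)|+1$. Tree factorial: $1/\tau!$ is defined recursively by $1/\bullet!=1$ and, for $|\tau|>1$, $$\frac{|\tau|}{\tau!}=\sum_{\tau'}\frac{m_\alpha(\tau',\tau)}{\tau'!}+\sum_{\tau'}\frac{m_\beta(\tau',\tau)}{\tau'!},$$ where $m_\alpha(\tau',\tau)$ is the number of $\alpha$-coloured leaves of $\tau$ whose removal yields $\tau'$, $m_\beta(\tau',\tau)$ is the number of pairs of $\beta$-vertices with the same exotic decoration, both leaves of $\tau$, whose simultaneous removal yields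 $\tau'$, and sums run over isomorphism classes. Empty sums are zero (in which case $1/\tau!=0$). Exotic realization map: $\Theta$ is the Heaviside function with $\Theta(0)=0$. $\Pi^{\mathfrak e}_t(\bullet)=1$ and, for $|\tau|>1$, $$\Pi^{\mathfrak e}_t(\tau)=\int\ \prod_{e:\,e_+=\rho_\tau}\Theta(t-t_{e_-})\prod_{e:\,e_+\ne\rho_\tau}\Theta(t_{e_+}-t_{e_-})\prod_{\{v,w\}:\,\mathfrak e(v)=\mathfrak e(w)}\delta(t_v-t_w)\prod_{v\neq\rho_\tau}dt_v,$$ where each edge $e=(e_+,e_-)$ points from $e_-$ towards $e_+$ (the endpoint closer to the root) and all variables range over $[0,T]$. The Dirac deltas mean that the integration variables of two $\beta$-vertices in the same pair are identified; thus the integral is over $[0,T]^{|\tau|-1}$ with one variable per $\alpha$-vertex and one per pair of $\beta$-vertices, and the integrand is the product of Heaviside factors over the edges with paired variables identified. *)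

theory Defs
  imports "HOL-Analysis.Analysis" "HOL-Library.Disjoint_Sets"
begin

section \<open>Exotic coloured trees\<close>

datatype colour = Alpha | Beta

text \<open>
  An edge \<open>(u, v) \<in> edges t\<close> points from \<open>u\<close> to \<open>v\<close>, i.e. \<open>u\<close> is \<open>e\<^sub>-\<close> and \<open>v\<close> is \<open>e\<^sub>+\<close>.
  The value of \<^term>\<open>colour\<close> at the root and outside the vertex set carries no meaning:
  nothing below depends on it. Every finite tree has a copy whose vertices are natural numbers,
  and only isomorphism classes matter in the end.
\<close>

record tree_rep =
  verts :: "nat set"
  root :: nat
  edges :: "(nat \<times> nat) set"
  colour :: "nat \<Rightarrow> colour"
  pairs :: "nat set set"

definition colour_verts :: "colour \<Rightarrow> tree_rep \<Rightarrow> nat set" where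
  "colour_verts c t = {v \<in> verts t - {root t}. colour t v = c}"

abbreviation alpha_verts :: "tree_rep \<Rightarrow> nat set" where
  "alpha_verts \<equiv> colour_verts Alpha"

abbreviation beta_verts :: "tree_rep \<Rightarrow> nat set" where
  "beta_verts \<equiv> colour_verts Beta"

text \<open>
  A finite digraph is a tree with edges oriented towards the root iff the root has no outgoing edge,
  every other vertex has exactly one, and the root can be reached from everywhere.
  A partition of the \<open>\<beta>\<close>-vertices into pairs can only exist if their number is even.
\<close>

definition exotic_tree_rep :: "tree_rep \<Rightarrow> bool" where
  "exotic_tree_rep t \<longleftrightarrow>
     finite (verts t) \<and> root t \<in> verts t \<and> edges t \<subseteq> verts t \<times> verts t \<and>
     (\<forall>v. (root t, v) \<notin> edges t) \<and>
     (\<forall>u \<in> verts t - {root t}. \<exists>!v. (u, v) \<in> edges t) \<and>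
     (\<forall>u \<in> verts t. (u, root t) \<in> (edges t)\<^sup>*) \<and>
     partition_on (beta_verts t) (pairs t) \<and> (\<forall>p \<in> pairs t. card p = 2)"

definition is_iso :: "(nat \<Rightarrow> nat) \<Rightarrow> tree_rep \<Rightarrow> tree_rep \<Rightarrow> bool" where
  "is_iso f s t \<longleftrightarrow>
     bij_betw f (verts s) (verts t) \<and> f (root s) = root t \<and>
     edges t = map_prod f f ` edges s \<and>
     (\<forall>v \<in> verts s - {root s}. colour t (f v) = colour s v) \<and>
     pairs t = (\<lambda>p. f ` p) ` pairs s"

definition isomorphic :: "tree_rep \<Rightarrow> tree_rep \<Rightarrow> bool" where
  "isomorphic s t \<longleftrightarrow> (\<exists>f. is_iso f s t)"

definition leaf :: "tree_rep \<Rightarrow> nat \<Rightarrow> bool" where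
  "leaf t v \<longleftrightarrow> v \<in> verts t - {root t} \<and> (\<forall>u. (u, v) \<notin> edges t)"

definition remove_verts :: "nat set \<Rightarrow> tree_rep \<Rightarrow> tree_rep" where
  "remove_verts S t = \<lparr>
     verts = verts t - S,
     root = root t,
     edges = edges t \<inter> (verts t - S) \<times> (verts t - S),
     colour = colour t,
     pairs = {p \<in> pairs t. p \<inter> S = {}}\<rparr>"

subsection \<open>Isomorphism classes\<close>

definition exotic_equiv :: "tree_rep \<Rightarrow> tree_rep \<Rightarrow> bool" where
  "exotic_equiv s t \<longleftrightarrow> exotic_tree_rep s \<and> exotic_tree_rep t \<and> isomorphic s t"

definition bullet_rep :: tree_rep where
  "bullet_rep = \<lparr>verts = {0}, root = 0, edges = {}, colour = (\<lambda>_. Alpha), pairs = {}\<rparr>"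

lemma exotic_tree_rep_bullet: "exotic_tree_rep bullet_rep"
  by (auto simp: exotic_tree_rep_def bullet_rep_def colour_verts_def partition_on_def)

lemma is_iso_id: "is_iso id t t"
  by (auto simp: is_iso_def map_prod.id)

lemma is_isoD:
  assumes "is_iso f s t"
  shows "inj_on f (verts s)" "verts t = f ` verts s" "root t = f (root s)"
    "edges t = map_prod f f ` edges s" "pairs t = (\<lambda>p. f ` p) ` pairs s"
    "\<And>v. v \<in> verts s \<Longrightarrow> v \<noteq> root s \<Longrightarrow> colour t (f v) = colour s v"
  using assms by (auto simp: is_iso_def bij_betw_def)

lemma exotic_tree_repD:
  assumes "exotic_tree_rep t"
  shows "finite (verts t)" "root t \<in> verts t" "edges t \<subseteq> verts t \<times> verts t"
    "\<And>v. (root t, v) \<notin> edges t" "\<And>u. u \<in> verts t \<Longrightarrow> (u, root t) \<in> (edges t)\<^sup>*"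
    "\<Union>(pairs t) = beta_verts t" "disjoint (pairs t)" "\<And>p. p \<in> pairs t \<Longrightarrow> card p = 2"
    "\<And>p. p \<in> pairs t \<Longrightarrow> p \<subseteq> beta_verts t"
    "\<And>p. p \<in> pairs t \<Longrightarrow> p \<subseteq> verts t - {root t}"
  using assms by (auto simp: exotic_tree_rep_def partition_on_def colour_verts_def)

lemma is_iso_non_root:
  assumes "exotic_tree_rep s" "is_iso f s t"
  shows "verts t - {root t} = f ` (verts s - {root s})"
  using exotic_tree_repD(2)[OF assms(1)] is_isoD(1-3)[OF assms(2)]
  by (auto simp: inj_on_def)

lemma is_iso_colour_verts:
  assumes "exotic_tree_rep s" "is_iso f s t"
  shows "colour_verts c t = f ` colour_verts c s"
  using is_iso_non_root[OF assms] is_isoD(6)[OF assms(2)]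
  unfolding colour_verts_def by auto

lemma is_iso_comp:
  assumes "exotic_tree_rep s" "is_iso f s t" "is_iso g t u"
  shows "is_iso (g \<circ> f) s u"
proof -
  have "colour u (g (f v)) = colour s v" if v: "v \<in> verts s - {root s}" for v
  proof -
    have "f v \<in> verts t - {root t}"
      using is_iso_non_root[OF assms(1,2)] v by blast
    then show ?thesis
      using is_isoD(6)[OF assms(2)] is_isoD(6)[OF assms(3)] v by auto
  qed
  then show ?thesis
    using assms(2,3) unfolding is_iso_def
    by (auto simp add: image_image map_prod.comp[symmetric] simp del: map_prod_simp
        intro: bij_betw_trans)
qed

lemma is_iso_inv:
  assumes "exotic_tree_rep s" "is_iso f s t"
  shows "is_iso (inv_into (verts s) f) t s"
proof -
  let ?g = "inv_into (verts s) f"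
  note s = exotic_tree_repD[OF assms(1)] and f = is_isoD[OF assms(2)]
  have gf: "?g (f v) = v" if "v \<in> verts s" for v
    using f(1) that by simp
  have gfp: "?g ` f ` p = p" if "p \<in> pairs s" for p
    using gf s(10)[OF that] by (force simp: image_image)
  have "map_prod ?g ?g (map_prod f f e) = e" if "e \<in> edges s" for e
    using gf s(3) that by (cases e) auto
  then have "edges s = map_prod ?g ?g ` edges t"
    by (simp add: f(4) image_image)
  moreover have "pairs s = (\<lambda>p. ?g ` p) ` pairs t"
    using gfp by (simp add: f(5) image_image)
  moreover have "colour s (?g v) = colour t v" if v: "v \<in> verts t - {root t}" for v
  proof -
    obtain w where w: "w \<in> verts s - {root s}" "v = f w"
      using is_iso_non_root[OF assms] v by blast
    then show ?thesis using f(6) gf by auto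
  qed
  moreover have "bij_betw ?g (verts t) (verts s)"
    using assms(2) by (auto simp: is_iso_def intro: bij_betw_inv_into)
  moreover have "?g (root t) = root s"
    using f(3) gf s(2) by auto
  ultimately show ?thesis by (auto simp: is_iso_def)
qed

lemma exotic_equiv_sym: "exotic_equiv s t \<Longrightarrow> exotic_equiv t s"
  unfolding exotic_equiv_def isomorphic_def using is_iso_inv by blast

lemma exotic_equiv_trans: "exotic_equiv s t \<Longrightarrow> exotic_equiv t u \<Longrightarrow> exotic_equiv s u"
  unfolding exotic_equiv_def isomorphic_def using is_iso_comp by blast

lemma part_equivp_exotic_equiv: "part_equivp exotic_equiv"
proof (rule part_equivpI)
  show "\<exists>t. exotic_equiv t t"
    using exotic_tree_rep_bullet is_iso_id unfolding exotic_equiv_def isomorphic_def by blast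
  show "symp exotic_equiv" "transp exotic_equiv"
    using exotic_equiv_sym exotic_equiv_trans by (blast intro: sympI transpI)+
qed

lemma is_iso_leaf:
  assumes "exotic_tree_rep s" "is_iso f s t" "v \<in> verts s"
  shows "leaf t (f v) \<longleftrightarrow> leaf s v"
proof -
  note s = exotic_tree_repD[OF assms(1)] and f = is_isoD[OF assms(2)]
  have "f v \<in> verts t - {root t} \<longleftrightarrow> v \<in> verts s - {root s}"
    using f(1-3) s(2) assms(3) by (auto simp: inj_on_def)
  moreover have "(\<exists>u. (u, f v) \<in> edges t) \<longleftrightarrow> (\<exists>u. (u, v) \<in> edges s)"
  proof
    assume "\<exists>u. (u, f v) \<in> edges t"
    then obtain a b where ab: "(a, b) \<in> edges s" "f v = f b" using f(4) by auto
    then have "b = v" using f(1) s(3) assms(3) by (auto simp: inj_on_def)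
    then show "\<exists>u. (u, v) \<in> edges s" using ab by auto
  next
    assume "\<exists>u. (u, v) \<in> edges s"
    then show "\<exists>u. (u, f v) \<in> edges t" using f(4) by force
  qed
  ultimately show ?thesis by (auto simp: leaf_def)
qed

lemma is_iso_remove_verts:
  assumes "exotic_tree_rep s" "is_iso f s t" "S \<subseteq> verts s - {root s}"
  shows "is_iso f (remove_verts S s) (remove_verts (f ` S) t)"
proof -
  note s = exotic_tree_repD[OF assms(1)] and f = is_isoD[OF assms(2)]
  have V: "f ` verts s - f ` S = f ` (verts s - S)"
    using f(1) assms(3) by (auto simp: inj_on_def)
  have mem: "f v \<in> f ` (verts s - S) \<longleftrightarrow> v \<in> verts s - S" if "v \<in> verts s" for v
    using f(1) that by (auto simp: inj_on_def)
  have E: "map_prod f f ` edges s \<inter> f ` (verts s - S) \<times> f ` (verts s - S)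
      = map_prod f f ` (edges s \<inter> (verts s - S) \<times> (verts s - S))" (is "?L = ?R")
  proof
    show "?L \<subseteq> ?R"
    proof
      fix x assume "x \<in> ?L"
      then obtain a b where ab: "(a, b) \<in> edges s" "x = (f a, f b)"
        "f a \<in> f ` (verts s - S)" "f b \<in> f ` (verts s - S)"
        by (elim IntE imageE) (auto simp del: image_iff imageE)
      have "a \<in> verts s - S" "b \<in> verts s - S"
        using ab mem[of a] mem[of b] s(3) by blast+
      then have "(a, b) \<in> edges s \<inter> (verts s - S) \<times> (verts s - S)" using ab(1) by blast
      then show "x \<in> ?R" unfolding ab(2) by (intro image_eqI[of _ _ "(a, b)"]) auto
    qed
  qed auto
  have P: "f ` p \<inter> f ` S = {} \<longleftrightarrow> p \<inter> S = {}" if "p \<in> pairs s" for p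
    using inj_on_image_Int[OF f(1), of p S] s(10)[OF that] assms(3) by auto
  have "{p \<in> (\<lambda>p. f ` p) ` pairs s. p \<inter> f ` S = {}} = (\<lambda>p. f ` p) ` {p \<in> pairs s. p \<inter> S = {}}"
    using P by auto
  moreover have "inj_on f (verts s - S)"
    using f(1) by (rule inj_on_subset) auto
  ultimately show ?thesis
    using V E f by (auto simp: is_iso_def remove_verts_def bij_betw_def)
qed

lemma exotic_tree_rep_remove_verts:
  assumes "exotic_tree_rep t" "\<forall>v \<in> S. leaf t v"
    and S: "\<And>p. p \<in> pairs t \<Longrightarrow> p \<inter> S = {} \<or> p \<subseteq> S"
  shows "exotic_tree_rep (remove_verts S t)"
proof -
  note t = exotic_tree_repD[OF assms(1)]
  let ?E = "edges t \<inter> (verts t - S) \<times> (verts t - S)"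
  have tgt: "v \<in> verts t - S" if "(u, v) \<in> edges t" for u v
    using that t(3) assms(2) by (auto simp: leaf_def)
  have E: "(u, v) \<in> ?E \<longleftrightarrow> (u, v) \<in> edges t" if "u \<in> verts t - S" for u v
    using tgt[of u v] that by auto
  have reach: "u \<in> verts t - S \<longrightarrow> (u, root t) \<in> ?E\<^sup>*" if "(u, root t) \<in> (edges t)\<^sup>*" for u
    using that
  proof (induction rule: converse_rtrancl_induct)
    case (step y z)
    then show ?case using E[of y z] tgt[of y z] by (auto intro: converse_rtrancl_into_rtrancl)
  qed auto
  have ex1: "\<exists>!v. (u, v) \<in> ?E" if "u \<in> verts t - S - {root t}" for u
  proof -
    have "\<exists>!v. (u, v) \<in> edges t" using assms(1) that by (auto simp: exotic_tree_rep_def)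
    then show ?thesis using E that by auto
  qed
  have rS: "root t \<notin> S" using assms(2) by (auto simp: leaf_def)
  have Un: "\<Union>{p \<in> pairs t. p \<inter> S = {}} = beta_verts t - S"
    using t(6) S by blast
  have b: "beta_verts (remove_verts S t) = beta_verts t - S"
    by (auto simp: colour_verts_def remove_verts_def)
  have "partition_on (beta_verts t - S) {p \<in> pairs t. p \<inter> S = {}}"
    using assms(1) Un unfolding exotic_tree_rep_def partition_on_def
    by (auto simp: disjoint_def)
  then show ?thesis
    using t ex1 rS b reach unfolding exotic_tree_rep_def
    by (auto simp: remove_verts_def)
qed

quotient_type exotic_tree = tree_rep / partial: exotic_equiv
  by (rule part_equivp_exotic_equiv)

lift_definition bullet :: exotic_tree is bullet_rep
  using exotic_tree_rep_bullet is_iso_id by (auto simp: exotic_equiv_def isomorphic_def)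

lemma exotic_equivE:
  assumes "exotic_equiv s t"
  obtains f where "exotic_tree_rep s" "exotic_tree_rep t" "is_iso f s t"
  using assms by (auto simp: exotic_equiv_def isomorphic_def)

lemma card_colour_verts_iso:
  assumes "exotic_tree_rep s" "is_iso f s t"
  shows "card (colour_verts c t) = card (colour_verts c s)"
proof -
  have "inj_on f (colour_verts c s)"
    using is_isoD(1)[OF assms(2)] by (rule inj_on_subset) (auto simp: colour_verts_def)
  then show ?thesis by (simp add: is_iso_colour_verts[OF assms] card_image)
qed

section \<open>Size and tree factorial\<close>

text \<open>The size \<open>|\<tau>|\<close>; the division by 2 is exact.\<close>

lift_definition tree_size :: "exotic_tree \<Rightarrow> nat"
  is "\<lambda>t. card (alpha_verts t) + card (beta_verts t) div 2 + 1"
  by (erule exotic_equivE) (simp add: card_colour_verts_iso)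

lemma tree_size_eq_1_iff: "tree_size \<tau> = 1 \<longleftrightarrow> \<tau> = bullet"
proof transfer
  fix t assume "exotic_equiv t t"
  then have wf: "exotic_tree_rep t" by (simp add: exotic_equiv_def)
  note t = exotic_tree_repD[OF wf]
  have fin: "finite (alpha_verts t)" "finite (beta_verts t)"
    using t(1) by (auto simp: colour_verts_def)
  show "card (alpha_verts t) + card (beta_verts t) div 2 + 1 = 1 \<longleftrightarrow> exotic_equiv t bullet_rep"
    (is "?L \<longleftrightarrow> ?R")
  proof
    assume ?L
    then have a: "alpha_verts t = {}" and b: "card (beta_verts t) < 2" using fin by auto
    have "card p < 2" if "p \<in> pairs t" for p
      using card_mono[OF fin(2) t(9)[OF that]] b by simp
    then have p: "pairs t = {}" using t(8) by force
    then have "beta_verts t = {}" using t(6) by simp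
    then have "verts t - {root t} = {}"
      using a colour.exhaust unfolding colour_verts_def by blast
    then have V: "verts t = {root t}" using t(2) by blast
    have E: "edges t = {}" using t(3,4) V by auto
    have "is_iso (\<lambda>_. 0) t bullet_rep"
      using V E p by (simp add: is_iso_def bullet_rep_def bij_betw_def)
    then show ?R using wf exotic_tree_rep_bullet by (auto simp: exotic_equiv_def isomorphic_def)
  next
    assume ?R
    then obtain f where "is_iso f t bullet_rep" by (rule exotic_equivE)
    then have "card (colour_verts c t) = 0" for c
      using card_colour_verts_iso[OF wf, of f bullet_rep c]
      by (simp add: colour_verts_def bullet_rep_def)
    then show ?L by simp
  qed
qed

lemma remove_verts_equiv:
  assumes "exotic_equiv s' t'" "exotic_tree_rep s" "exotic_tree_rep t" "is_iso f s t"
    and "\<forall>v \<in> S. leaf s v" "\<And>p. p \<in> pairs s \<Longrightarrow> p \<inter> S = {} \<or> p \<subseteq> S"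
  shows "exotic_equiv s' (remove_verts S s) \<longleftrightarrow> exotic_equiv t' (remove_verts (f ` S) t)"
proof -
  have S: "S \<subseteq> verts s - {root s}" using assms(5) by (auto simp: leaf_def)
  have iso: "is_iso f (remove_verts S s) (remove_verts (f ` S) t)"
    using is_iso_remove_verts[OF assms(2,4) S] .
  have "exotic_tree_rep (remove_verts (f ` S) t)"
  proof (rule exotic_tree_rep_remove_verts[OF assms(3)])
    show "\<forall>v \<in> f ` S. leaf t v" using is_iso_leaf[OF assms(2,4)] assms(5) S by auto
    show "p \<inter> f ` S = {} \<or> p \<subseteq> f ` S" if p: "p \<in> pairs t" for p
    proof -
      obtain q where q: "q \<in> pairs s" "p = f ` q"
        using p unfolding is_isoD(5)[OF assms(4)] by blast
      have "f ` (q \<inter> S) = p \<inter> f ` S"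
        using inj_on_image_Int[OF is_isoD(1)[OF assms(4)], of q S] q
          exotic_tree_repD(10)[OF assms(2) q(1)] S by auto
      then show ?thesis using assms(6)[OF q(1)] q(2) by auto
    qed
  qed
  then have "exotic_equiv (remove_verts S s) (remove_verts (f ` S) t)"
    using iso exotic_tree_rep_remove_verts[OF assms(2,5,6)]
    by (auto simp: exotic_equiv_def isomorphic_def)
  then show ?thesis
    using assms(1) by (meson exotic_equiv_sym exotic_equiv_trans)
qed

text \<open>In \<open>m_alpha \<tau>' \<tau>\<close> and \<open>m_beta \<tau>' \<tau>\<close> the vertices are removed from the second argument.\<close>

lift_definition m_alpha :: "exotic_tree \<Rightarrow> exotic_tree \<Rightarrow> nat"
  is "\<lambda>t' t. card {v \<in> alpha_verts t. leaf t v \<and> exotic_equiv t' (remove_verts {v} t)}"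
proof -
  fix s' t' s t assume eq': "exotic_equiv s' t'" and "exotic_equiv s t"
  then obtain f where f: "exotic_tree_rep s" "exotic_tree_rep t" "is_iso f s t"
    by (auto elim: exotic_equivE)
  let ?A = "{v \<in> alpha_verts s. leaf s v \<and> exotic_equiv s' (remove_verts {v} s)}"
  let ?B = "{v \<in> alpha_verts t. leaf t v \<and> exotic_equiv t' (remove_verts {v} t)}"
  have *: "leaf t (f v) \<and> exotic_equiv t' (remove_verts {f v} t) \<longleftrightarrow>
      leaf s v \<and> exotic_equiv s' (remove_verts {v} s)" if v: "v \<in> alpha_verts s" for v
  proof -
    have "p \<inter> {v} = {}" if "p \<in> pairs s" for p
      using exotic_tree_repD(9)[OF f(1) that] v by (auto simp: colour_verts_def)
    then show ?thesis
      using remove_verts_equiv[OF eq' f, of "{v}"] is_iso_leaf[OF f(1,3), of v] v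
      by (auto simp: colour_verts_def)
  qed
  have "?B = f ` ?A"
    using * unfolding is_iso_colour_verts[OF f(1,3), of Alpha] by auto
  moreover have "inj_on f ?A"
    using is_isoD(1)[OF f(3)] by (rule inj_on_subset) (auto simp: colour_verts_def)
  ultimately show "card ?A = card ?B" by (simp add: card_image)
qed

lift_definition m_beta :: "exotic_tree \<Rightarrow> exotic_tree \<Rightarrow> nat"
  is "\<lambda>t' t. card {p \<in> pairs t. (\<forall>v \<in> p. leaf t v) \<and> exotic_equiv t' (remove_verts p t)}"
proof -
  fix s' t' s t assume eq': "exotic_equiv s' t'" and "exotic_equiv s t"
  then obtain f where f: "exotic_tree_rep s" "exotic_tree_rep t" "is_iso f s t"
    by (auto elim: exotic_equivE)
  let ?A = "{p \<in> pairs s. (\<forall>v \<in> p. leaf s v) \<and> exotic_equiv s' (remove_verts p s)}"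
  let ?B = "{p \<in> pairs t. (\<forall>v \<in> p. leaf t v) \<and> exotic_equiv t' (remove_verts p t)}"
  have *: "(\<forall>v \<in> f ` p. leaf t v) \<and> exotic_equiv t' (remove_verts (f ` p) t) \<longleftrightarrow>
      (\<forall>v \<in> p. leaf s v) \<and> exotic_equiv s' (remove_verts p s)" if p: "p \<in> pairs s" for p
  proof -
    have "q \<inter> p = {} \<or> q \<subseteq> p" if "q \<in> pairs s" for q
      using exotic_tree_repD(7)[OF f(1)] that p by (auto simp: disjoint_def)
    then show ?thesis
      using remove_verts_equiv[OF eq' f, of p] is_iso_leaf[OF f(1,3)]
        exotic_tree_repD(10)[OF f(1) p] by blast
  qed
  have "?B = (\<lambda>p. f ` p) ` ?A"
    using * unfolding is_isoD(5)[OF f(3)] by auto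
  moreover have "inj_on (\<lambda>p. f ` p) ?A"
  proof (rule inj_onI)
    fix p q assume "p \<in> ?A" "q \<in> ?A" "f ` p = f ` q"
    then show "p = q"
      using inj_on_image_eq_iff[OF is_isoD(1)[OF f(3)], of p q] exotic_tree_repD(10)[OF f(1)]
      by blast
  qed
  ultimately show "card ?A = card ?B" by (simp add: card_image)
qed

lemma tree_size_equiv:
  "exotic_equiv s t \<Longrightarrow> card (alpha_verts s) + card (beta_verts s) div 2
     = card (alpha_verts t) + card (beta_verts t) div 2"
  by (erule exotic_equivE) (simp add: card_colour_verts_iso)

lemma tree_size_m_alpha: "m_alpha \<sigma> \<tau> \<noteq> 0 \<Longrightarrow> tree_size \<sigma> < tree_size \<tau>"
proof transfer
  fix s t
  assume t: "exotic_equiv t t"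
  assume "card {v \<in> alpha_verts t. leaf t v \<and> exotic_equiv s (remove_verts {v} t)} \<noteq> 0"
  then obtain v where v: "v \<in> alpha_verts t" "exotic_equiv s (remove_verts {v} t)"
    by (metis (mono_tags, lifting) card_eq_0_iff empty_Collect_eq)
  have "alpha_verts (remove_verts {v} t) = alpha_verts t - {v}"
    "beta_verts (remove_verts {v} t) = beta_verts t"
    using v(1) by (auto simp: colour_verts_def remove_verts_def)
  moreover have "finite (alpha_verts t)"
    using t by (auto simp: exotic_equiv_def colour_verts_def dest: exotic_tree_repD(1))
  then have "card (alpha_verts t - {v}) < card (alpha_verts t)"
    using v(1) by (intro psubset_card_mono) auto
  ultimately show "card (alpha_verts s) + card (beta_verts s) div 2 + 1
      < card (alpha_verts t) + card (beta_verts t) div 2 + 1"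
    using tree_size_equiv[OF v(2)] by simp
qed

lemma tree_size_m_beta: "m_beta \<sigma> \<tau> \<noteq> 0 \<Longrightarrow> tree_size \<sigma> < tree_size \<tau>"
proof transfer
  fix s t
  assume "exotic_equiv t t"
  then have t: "exotic_tree_rep t" by (simp add: exotic_equiv_def)
  assume "card {p \<in> pairs t. (\<forall>v \<in> p. leaf t v) \<and> exotic_equiv s (remove_verts p t)} \<noteq> 0"
  then obtain p where p: "p \<in> pairs t" "exotic_equiv s (remove_verts p t)"
    by (metis (mono_tags, lifting) card_eq_0_iff empty_Collect_eq)
  have p2: "card p = 2" "p \<subseteq> beta_verts t"
    using exotic_tree_repD(8,9)[OF t] p(1) by auto
  have "alpha_verts (remove_verts p t) = alpha_verts t"
    "beta_verts (remove_verts p t) = beta_verts t - p"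
    using p2(2) by (auto simp: colour_verts_def remove_verts_def)
  moreover have fin: "finite (beta_verts t)"
    using exotic_tree_repD(1)[OF t] by (auto simp: colour_verts_def)
  then have "card (beta_verts t - p) = card (beta_verts t) - 2"
    using p2 by (simp add: card_Diff_subset finite_subset)
  moreover have "2 \<le> card (beta_verts t)"
    using card_mono[OF fin p2(2)] p2(1) by simp
  ultimately show "card (alpha_verts s) + card (beta_verts s) div 2 + 1
      < card (alpha_verts t) + card (beta_verts t) div 2 + 1"
    using tree_size_equiv[OF p(2)] by simp
qed

text \<open>
  \<open>inv_tree_factorial \<tau>\<close> is \<open>1/\<tau>!\<close>, which may vanish; \<open>\<tau>!\<close> itself is not defined. The sums over all isomorphism classes are
  restricted to their supports, which are finite.
\<close>

function inv_tree_factorial :: "exotic_tree \<Rightarrow> real" where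
  "inv_tree_factorial \<tau> =
     (if \<tau> = bullet then 1
      else ((\<Sum>\<sigma> \<in> {\<sigma>. m_alpha \<sigma> \<tau> \<noteq> 0}. real (m_alpha \<sigma> \<tau>) * inv_tree_factorial \<sigma>)
          + (\<Sum>\<sigma> \<in> {\<sigma>. m_beta \<sigma> \<tau> \<noteq> 0}. real (m_beta \<sigma> \<tau>) * inv_tree_factorial \<sigma>))
        / real (tree_size \<tau>))"
  by auto
termination
  by (relation "Wellfounded.measure tree_size") (auto intro: tree_size_m_alpha tree_size_m_beta)

declare inv_tree_factorial.simps [simp del]

lemma abs_exotic_tree_eqI:
  "exotic_equiv s t \<Longrightarrow> abs_exotic_tree s = abs_exotic_tree t"
  using Quotient_rel_abs[OF Quotient_exotic_tree] .

lemma rep_exotic_tree_equiv: "exotic_equiv (rep_exotic_tree \<tau>) (rep_exotic_tree \<tau>)"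
  using Quotient_rep_reflp[OF Quotient_exotic_tree] .

lemma finite_m_alpha_support: "finite {\<sigma>. m_alpha \<sigma> \<tau> \<noteq> 0}"
proof (rule finite_subset)
  let ?t = "rep_exotic_tree \<tau>"
  have t: "exotic_tree_rep ?t"
    using rep_exotic_tree_equiv by (simp add: exotic_equiv_def)
  show "finite ((\<lambda>v. abs_exotic_tree (remove_verts {v} ?t)) ` verts ?t)"
    using exotic_tree_repD(1)[OF t] by simp
  show "{\<sigma>. m_alpha \<sigma> \<tau> \<noteq> 0} \<subseteq> (\<lambda>v. abs_exotic_tree (remove_verts {v} ?t)) ` verts ?t"
  proof
    fix \<sigma> assume "\<sigma> \<in> {\<sigma>. m_alpha \<sigma> \<tau> \<noteq> 0}"
    then obtain v where "v \<in> alpha_verts ?t"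
      "exotic_equiv (rep_exotic_tree \<sigma>) (remove_verts {v} ?t)"
      by (auto simp: m_alpha.rep_eq card_gt_0_iff)
    then show "\<sigma> \<in> (\<lambda>v. abs_exotic_tree (remove_verts {v} ?t)) ` verts ?t"
      using abs_exotic_tree_eqI Quotient_abs_rep[OF Quotient_exotic_tree, of \<sigma>]
      by (fastforce simp: colour_verts_def)
  qed
qed

lemma finite_m_beta_support: "finite {\<sigma>. m_beta \<sigma> \<tau> \<noteq> 0}"
proof (rule finite_subset)
  let ?t = "rep_exotic_tree \<tau>"
  have t: "exotic_tree_rep ?t"
    using rep_exotic_tree_equiv by (simp add: exotic_equiv_def)
  have "pairs ?t \<subseteq> Pow (verts ?t)" using exotic_tree_repD(10)[OF t] by blast
  then show "finite ((\<lambda>p. abs_exotic_tree (remove_verts p ?t)) ` pairs ?t)"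
    using exotic_tree_repD(1)[OF t] by (auto intro: finite_subset)
  show "{\<sigma>. m_beta \<sigma> \<tau> \<noteq> 0} \<subseteq> (\<lambda>p. abs_exotic_tree (remove_verts p ?t)) ` pairs ?t"
  proof
    fix \<sigma> assume "\<sigma> \<in> {\<sigma>. m_beta \<sigma> \<tau> \<noteq> 0}"
    then obtain p where "p \<in> pairs ?t"
      "exotic_equiv (rep_exotic_tree \<sigma>) (remove_verts p ?t)"
      by (auto simp: m_beta.rep_eq card_gt_0_iff)
    then show "\<sigma> \<in> (\<lambda>p. abs_exotic_tree (remove_verts p ?t)) ` pairs ?t"
      using abs_exotic_tree_eqI Quotient_abs_rep[OF Quotient_exotic_tree, of \<sigma>] by fastforce
  qed
qed

section \<open>Exotic realization map\<close>

definition heaviside :: "real \<Rightarrow> real" where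
  "heaviside x = (if x > 0 then 1 else 0)"

text \<open>
  The Dirac factors identify the variables of paired vertices. Hence the integration variables are
  indexed by the classes of non-root vertices with identified variables, that is, by \<open>{v}\<close> for
  \<open>\<alpha>\<close>-vertices \<open>v\<close> and by the pairs of \<open>\<beta>\<close>-vertices.
\<close>

definition var_of :: "tree_rep \<Rightarrow> nat \<Rightarrow> nat set" where
  "var_of t v = insert v (\<Union>{p \<in> pairs t. v \<in> p})"

definition int_vars :: "tree_rep \<Rightarrow> nat set set" where
  "int_vars t = var_of t ` (verts t - {root t})"

definition realization_integrand :: "real \<Rightarrow> tree_rep \<Rightarrow> (nat set \<Rightarrow> real) \<Rightarrow> real" where
  "realization_integrand s t x =
     (\<Prod>(u, v) \<in> edges t. if v = root t then heaviside (s - x (var_of t u))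
                        else heaviside (x (var_of t v) - x (var_of t u)))"

definition realization_integral :: "real \<Rightarrow> real \<Rightarrow> tree_rep \<Rightarrow> real" where
  "realization_integral T s t =
     (LINT x:(\<Pi>\<^sub>E i\<in>int_vars t. {0..T})|(\<Pi>\<^sub>M i\<in>int_vars t. lborel). realization_integrand s t x)"

lemma int_vars_eq:
  assumes "exotic_tree_rep t"
  shows "int_vars t = (\<lambda>v. {v}) ` alpha_verts t \<union> pairs t"
proof -
  note t = exotic_tree_repD[OF assms]
  have a: "var_of t v = {v}" if "v \<in> alpha_verts t" for v

  proof -
    have "v \<notin> p" if "p \<in> pairs t" for p
      using t(9)[OF that] \<open>v \<in> alpha_verts t\<close> by (auto simp: colour_verts_def)
    then show ?thesis unfolding var_of_def by blast
  qed
  have b: "var_of t v = p" if "v \<in> p" "p \<in> pairs t" for v p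
  proof -
    have "{q \<in> pairs t. v \<in> q} = {p}" using that disjointD[OF t(7)] by blast
    then show ?thesis unfolding var_of_def using that by (simp add: insert_absorb)
  qed
  have ne: "p \<noteq> {}" if "p \<in> pairs t" for p using t(8)[OF that] by auto
  have "verts t - {root t} = alpha_verts t \<union> \<Union>(pairs t)"
    unfolding t(6) colour_verts_def using colour.exhaust by blast
  then have "int_vars t = var_of t ` alpha_verts t \<union> var_of t ` \<Union>(pairs t)"
    by (simp add: int_vars_def image_Un)
  also have "var_of t ` alpha_verts t = (\<lambda>v. {v}) ` alpha_verts t" using a by (rule image_cong[OF refl])
  also have "var_of t ` \<Union>(pairs t) = pairs t"
  proof
    show "var_of t ` \<Union>(pairs t) \<subseteq> pairs t" using b by auto
    show "pairs t \<subseteq> var_of t ` \<Union>(pairs t)"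
    proof
      fix p assume p: "p \<in> pairs t"
      then obtain v where "v \<in> p" using ne by blast
      then show "p \<in> var_of t ` \<Union>(pairs t)"
        using b[OF _ p] p by (intro image_eqI[of _ _ v]) auto
    qed
  qed
  finally show ?thesis .
qed

lemma is_iso_var_of:
  assumes "exotic_tree_rep s" "is_iso f s t" "v \<in> verts s"
  shows "var_of t (f v) = f ` var_of s v"
proof -
  have "f v \<in> f ` p \<longleftrightarrow> v \<in> p" if "p \<in> pairs s" for p
    using is_isoD(1)[OF assms(2)] exotic_tree_repD(10)[OF assms(1) that] assms(3)
    by (auto simp: inj_on_def)
  then show ?thesis
    unfolding var_of_def is_isoD(5)[OF assms(2)] by auto
qed

lemma var_of_subset:
  assumes "exotic_tree_rep t" "v \<in> verts t"
  shows "var_of t v \<subseteq> verts t"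
  using assms exotic_tree_repD(10)[OF assms(1)] by (auto simp: var_of_def)

lemma int_vars_subset:
  assumes "exotic_tree_rep t" "p \<in> int_vars t"
  shows "p \<subseteq> verts t"
  using assms(2) var_of_subset[OF assms(1)] unfolding int_vars_def by blast

lemma is_iso_int_vars:
  assumes "exotic_tree_rep s" "is_iso f s t"
  shows "bij_betw (\<lambda>p. f ` p) (int_vars s) (int_vars t)"
proof -
  have "inj_on (\<lambda>p. f ` p) (int_vars s)"
  proof (rule inj_onI)
    fix p q assume "p \<in> int_vars s" "q \<in> int_vars s" and eq: "f ` p = f ` q"
    then have "p \<subseteq> verts s" "q \<subseteq> verts s" using int_vars_subset[OF assms(1)] by blast+
    then show "p = q"
      using inj_on_image_eq_iff[OF is_isoD(1)[OF assms(2)]] eq by blast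
  qed
  moreover have "int_vars t = (\<lambda>v. var_of t (f v)) ` (verts s - {root s})"
    by (simp only: int_vars_def is_iso_non_root[OF assms] image_image)
  then have "int_vars t = (\<lambda>v. f ` var_of s v) ` (verts s - {root s})"
    using is_iso_var_of[OF assms] by (simp cong: image_cong_simp)
  then have "int_vars t = (\<lambda>p. f ` p) ` int_vars s"
    by (simp only: int_vars_def image_image)
  ultimately show ?thesis by (simp only: bij_betw_def simp_thms)
qed

lemma edge_tail_non_root:
  assumes "exotic_tree_rep t" "(u, v) \<in> edges t"
  shows "u \<in> verts t - {root t}" "v \<in> verts t"
  using exotic_tree_repD(3,4)[OF assms(1)] assms(2) by auto

lemma realization_integrand_iso:
  assumes "exotic_tree_rep s" "is_iso f s t"
  shows "realization_integrand r t y
    = realization_integrand r s (\<lambda>p\<in>int_vars s. y (f ` p))"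
proof -
  note s = exotic_tree_repD[OF assms(1)] and f = is_isoD[OF assms(2)]
  have inj: "inj_on (map_prod f f) (edges s)"
    using map_prod_inj_on[OF f(1) f(1)] s(3) by (rule inj_on_subset)
  have var: "var_of s v \<in> int_vars s" if "v \<in> verts s" "v \<noteq> root s" for v
    using that by (auto simp: int_vars_def)
  show ?thesis
    unfolding realization_integrand_def f(4) prod.reindex[OF inj] comp_def
  proof (rule prod.cong[OF refl], clarify)
    fix u v assume uv: "(u, v) \<in> edges s"
    have "f v = root t \<longleftrightarrow> v = root s"
      using f(1,3) s(2) edge_tail_non_root[OF assms(1) uv] by (auto simp: inj_on_def)
    then show "(case map_prod f f (u, v) of (u, v) \<Rightarrow>
        if v = root t then heaviside (r - y (var_of t u))
        else heaviside (y (var_of t v) - y (var_of t u))) =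
      (if v = root s then heaviside (r - (\<lambda>p\<in>int_vars s. y (f ` p)) (var_of s u))
        else heaviside ((\<lambda>p\<in>int_vars s. y (f ` p)) (var_of s v)
          - (\<lambda>p\<in>int_vars s. y (f ` p)) (var_of s u)))"
      using edge_tail_non_root[OF assms(1) uv] var is_iso_var_of[OF assms] by auto
  qed
qed

lemma finite_int_vars: "exotic_tree_rep t \<Longrightarrow> finite (int_vars t)"
  by (simp add: int_vars_def exotic_tree_repD(1))

lemma realization_integrand_measurable:
  assumes "exotic_tree_rep t"
  shows "realization_integrand r t \<in> borel_measurable (\<Pi>\<^sub>M i\<in>int_vars t. lborel)"
proof -
  have [measurable]: "heaviside \<in> borel_measurable borel"
    unfolding heaviside_def by measurable
  have var: "var_of t v \<in> int_vars t" if "v \<in> verts t - {root t}" for v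
    using that by (auto simp: int_vars_def)
  have [measurable]: "(\<lambda>x. x (var_of t v)) \<in> borel_measurable (\<Pi>\<^sub>M i\<in>int_vars t. lborel)"
    if "v \<in> verts t - {root t}" for v
    using measurable_component_singleton[OF var[OF that], of "\<lambda>_. lborel"] by simp
  show ?thesis
    unfolding realization_integrand_def
  proof (rule borel_measurable_prod, clarify)
    fix u v assume uv: "(u, v) \<in> edges t"
    have "u \<in> verts t - {root t}" using edge_tail_non_root[OF assms uv] by simp
    note [measurable] = this
    show "(\<lambda>x. if v = root t then heaviside (r - x (var_of t u))
        else heaviside (x (var_of t v) - x (var_of t u)))
      \<in> borel_measurable (\<Pi>\<^sub>M i\<in>int_vars t. lborel)"
    proof (cases "v = root t")
      case False
      then have [measurable]: "v \<in> verts t - {root t}"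
        using edge_tail_non_root[OF assms uv] by simp
      show ?thesis using False by simp
    qed simp
  qed
qed

lemma distr_PiM_lborel_reindex:
  assumes "finite I" "bij_betw h I J"
  shows "distr (\<Pi>\<^sub>M j\<in>J. lborel) (\<Pi>\<^sub>M i\<in>I. lborel) (\<lambda>y. \<lambda>i\<in>I. y (h i))
    = (\<Pi>\<^sub>M i\<in>I. (lborel :: real measure))"
proof -
  interpret product_sigma_finite "\<lambda>_. lborel :: real measure"
    by standard
  have fJ: "finite J" using assms by (simp add: bij_betw_finite)
  have hJ: "h i \<in> J" if "i \<in> I" for i using assms(2) that by (auto simp: bij_betw_def)
  have meas: "(\<lambda>y. \<lambda>i\<in>I. y (h i)) \<in> measurable (\<Pi>\<^sub>M j\<in>J. lborel) (\<Pi>\<^sub>M i\<in>I. (lborel :: real measure))"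
    using hJ by (intro measurable_restrict measurable_component_singleton) auto
  show ?thesis
  proof (rule PiM_eqI[OF assms(1)])
    fix A :: "_ \<Rightarrow> real set" assume A: "\<And>i. i \<in> I \<Longrightarrow> A i \<in> sets lborel"
    let ?k = "inv_into I h"
    have kh: "?k (h i) = i" if "i \<in> I" for i
      using assms(2) that by (simp add: bij_betw_def)
    have kJ: "?k j \<in> I" "h (?k j) = j" if "j \<in> J" for j
      using assms(2) that by (auto simp: bij_betw_def inv_into_into f_inv_into_f)
    have "(\<lambda>y. \<lambda>i\<in>I. y (h i)) -` (Pi\<^sub>E I A) \<inter> space (\<Pi>\<^sub>M j\<in>J. (lborel :: real measure))
        = (\<Pi>\<^sub>E j\<in>J. A (?k j))" (is "?L = ?R")
    proof (intro equalityI subsetI)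
      fix y assume y: "y \<in> ?L"
      have "y j \<in> A (?k j)" if "j \<in> J" for j
        using y kJ[OF that] by (auto simp: PiE_iff dest!: bspec[of I _ "?k j"])
      then show "y \<in> ?R" using y by (auto simp: space_PiM PiE_iff)
    next
      fix y assume y: "y \<in> ?R"
      have "y (h i) \<in> A i" if "i \<in> I" for i
        using y hJ[OF that] kh[OF that] by (auto simp: PiE_iff dest!: bspec[of J _ "h i"])
      then show "y \<in> ?L" using y by (auto simp: space_PiM PiE_iff)
    qed
    then have "emeasure (distr (\<Pi>\<^sub>M j\<in>J. lborel) (\<Pi>\<^sub>M i\<in>I. lborel) (\<lambda>y. \<lambda>i\<in>I. y (h i))) (Pi\<^sub>E I A)
        = emeasure (\<Pi>\<^sub>M j\<in>J. lborel) (\<Pi>\<^sub>E j\<in>J. A (?k j))"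
      using A assms(1) meas by (subst emeasure_distr) (auto intro!: sets_PiM_I_finite)
    also have "\<dots> = (\<Prod>j\<in>J. emeasure lborel (A (?k j)))"
      using A kJ by (intro emeasure_PiM fJ) auto
    also have "\<dots> = (\<Prod>i\<in>I. emeasure lborel (A i))"
      using kh by (subst prod.reindex_bij_betw[OF assms(2), symmetric]) (auto intro!: prod.cong)
    finally show "emeasure (distr (\<Pi>\<^sub>M j\<in>J. lborel) (\<Pi>\<^sub>M i\<in>I. lborel) (\<lambda>y. \<lambda>i\<in>I. y (h i))) (Pi\<^sub>E I A)
        = (\<Prod>i\<in>I. emeasure lborel (A i))" .
  qed simp
qed

lemma realization_integral_iso:
  assumes "exotic_tree_rep s" "is_iso f s t"
  shows "realization_integral T r s = realization_integral T r t"
proof -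
  let ?I = "int_vars s" and ?J = "int_vars t"
  let ?MI = "\<Pi>\<^sub>M i\<in>?I. (lborel :: real measure)" and ?MJ = "\<Pi>\<^sub>M i\<in>?J. (lborel :: real measure)"
  let ?h = "\<lambda>y. \<lambda>p\<in>?I. (y (f ` p) :: real)"
  have bij: "bij_betw (\<lambda>p. f ` p) ?I ?J" using is_iso_int_vars[OF assms] .
  have fI: "finite ?I" using finite_int_vars[OF assms(1)] .
  have hJ: "f ` p \<in> ?J" if "p \<in> ?I" for p using bij that by (auto simp: bij_betw_def)
  have meas: "?h \<in> measurable ?MJ ?MI"
    using hJ by (intro measurable_restrict measurable_component_singleton) auto
  have "realization_integral T r s
      = (\<integral>x. indicator (\<Pi>\<^sub>E i\<in>?I. {0..T}) x *\<^sub>R realization_integrand r s x \<partial>distr ?MJ ?MI ?h)"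
    unfolding realization_integral_def set_lebesgue_integral_def
      distr_PiM_lborel_reindex[OF fI bij] ..
  also have "\<dots> = (\<integral>y. indicator (\<Pi>\<^sub>E i\<in>?I. {0..T}) (?h y) *\<^sub>R realization_integrand r s (?h y) \<partial>?MJ)"
    using meas fI realization_integrand_measurable[OF assms(1)]
    by (intro integral_distr borel_measurable_scaleR borel_measurable_indicator
        sets_PiM_I_finite) auto
  also have "\<dots> = (\<integral>y. indicator (\<Pi>\<^sub>E i\<in>?J. {0..T}) y *\<^sub>R realization_integrand r t y \<partial>?MJ)"
  proof (rule Bochner_Integration.integral_cong[OF refl])
    fix y assume y: "y \<in> space ?MJ"
    have "?J = (\<lambda>p. f ` p) ` ?I" using bij by (simp add: bij_betw_def)
    then have "?h y \<in> (\<Pi>\<^sub>E i\<in>?I. {0..T}) \<longleftrightarrow> y \<in> (\<Pi>\<^sub>E i\<in>?J. {0..T})"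
      using y by (auto simp: PiE_iff space_PiM)
    then show "indicator (\<Pi>\<^sub>E i\<in>?I. {0..T}) (?h y) *\<^sub>R realization_integrand r s (?h y)
        = indicator (\<Pi>\<^sub>E i\<in>?J. {0..T}) y *\<^sub>R realization_integrand r t y"
      unfolding realization_integrand_iso[OF assms] by (simp add: indicator_def)
  qed
  finally show ?thesis unfolding realization_integral_def set_lebesgue_integral_def .
qed

lift_definition realization_integral_class :: "real \<Rightarrow> real \<Rightarrow> exotic_tree \<Rightarrow> real"
  is realization_integral
  by (erule exotic_equivE) (rule realization_integral_iso)

definition exotic_realization :: "real \<Rightarrow> real \<Rightarrow> exotic_tree \<Rightarrow> real" where
  "exotic_realization T t \<tau> = (if \<tau> = bullet then 1 else realization_integral_class T t \<tau>)"

end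

theory Submission
  imports Defs
begin

text \<open>
  Both sides of the identity count linear extensions. Let \<open>n = |\<tau>| - 1\<close> and let \<open>P\<close> be the set of the \<open>n\<close>
  integration variables (\<open>int_vars\<close>), with the relation (\<open>var_order\<close>) in which a variable lies below
  another one whenever an edge of the tree points from a vertex of the first to a vertex of the
  second. Because of the pairing, this relation may have cycles.

  For the integral: apart from a null set, the integrand restricted to \<open>[0,T]\<^sup>P\<close> is the indicator of
  the order polytope of \<open>P\<close> inside \<open>(0,t)\<^sup>P\<close>. The factors \<open>\<Theta>(t - t\<^sub>v)\<close> at the root suffice to push all
  variables below \<open>t\<close>, since along the path from any vertex to the root the variables increase. An
  order polytope of \<open>n\<close> variables in \<open>(a,b)\<close> has volume \<open>e (b - a)\<^sup>n / n!\<close>, where \<open>e\<close> is the number of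
  linear extensions (\<open>emeasure_open_order_polytope\<close>). To see this, split it according to the variable
  with the smallest value \<open>y\<close>. That variable must be minimal in \<open>P\<close>, its own constraints then hold
  automatically, and the others range over the order polytope of \<open>P\<close> without it in \<open>(y,b)\<close>.
  Integrate over \<open>y\<close> and use induction.

  For the tree factorial: a variable is minimal in \<open>P\<close> exactly if all its vertices are leaves, so the
  recursion for \<open>1/\<tau>!\<close> removes precisely the minimal elements of \<open>P\<close>, one at a time. A linear
  extension of \<open>P\<close> is a minimal element followed by a linear extension of the remainder, hence \<open>e\<close>
  obeys the same recursion up to normalization, and \<open>|\<tau>|/\<tau>! = e/n!\<close>
  (\<open>inv_tree_factorial_eq_card_linear_extensions\<close>). If the relation has a cycle, then \<open>e = 0\<close> and both
  sides vanish.
\<close>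

section \<open>Linear extensions\<close>

text \<open>
  The condition includes \<open>(p, p) \<notin> R\<close>: a \<open>\<beta>\<close>-vertex may be the parent of its partner, and then its
  variable would have to be smaller than itself.
\<close>

fun linear_extension :: "('i \<times> 'i) set \<Rightarrow> 'i list \<Rightarrow> bool" where
  "linear_extension R [] \<longleftrightarrow> True"
| "linear_extension R (p # ps) \<longleftrightarrow>
     (\<forall>i \<in> insert p (set ps). (i, p) \<notin> R) \<and> p \<notin> set ps \<and> linear_extension R ps"

definition linear_extensions :: "('i \<times> 'i) set \<Rightarrow> 'i set \<Rightarrow> 'i list set" where
  "linear_extensions R I = {ps. set ps = I \<and> linear_extension R ps}"

definition minimal_elements :: "('i \<times> 'i) set \<Rightarrow> 'i set \<Rightarrow> 'i set" where
  "minimal_elements R I = {p \<in> I. \<forall>i \<in> I. (i, p) \<notin> R}"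

lemma linear_extension_cong:
  assumes "R \<inter> set ps \<times> set ps = S \<inter> set ps \<times> set ps"
  shows "linear_extension R ps \<longleftrightarrow> linear_extension S ps"
  using assms
proof (induction ps)
  case (Cons p ps)
  have eq: "(i, j) \<in> R \<longleftrightarrow> (i, j) \<in> S" if "i \<in> set (p # ps)" "j \<in> set (p # ps)" for i j
    using Cons.prems that by blast
  have "linear_extension R ps \<longleftrightarrow> linear_extension S ps"
    by (rule Cons.IH) (use eq in auto)
  then show ?case using eq by auto
qed simp

lemma linear_extensions_cong:
  "R \<inter> I \<times> I = S \<inter> I \<times> I \<Longrightarrow> linear_extensions R I = linear_extensions S I"
  unfolding linear_extensions_def
  using linear_extension_cong[of R _ S] by (intro Collect_cong conj_cong refl) simp

lemma linear_extensions_empty: "linear_extensions R {} = {[]}"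
  by (auto simp: linear_extensions_def)

lemma linear_extension_distinct: "linear_extension R ps \<Longrightarrow> distinct ps"
  by (induction ps) auto

lemma finite_linear_extensions:
  assumes "finite I"
  shows "finite (linear_extensions R I)"
proof (rule finite_subset)
  show "linear_extensions R I \<subseteq> {ps. set ps \<subseteq> I \<and> length ps = card I}"
    using linear_extension_distinct distinct_card by (fastforce simp: linear_extensions_def)
  show "finite {ps. set ps \<subseteq> I \<and> length ps = card I}"
    using finite_lists_length_eq[OF assms] .
qed

lemma card_linear_extensions_rec:
  assumes "finite I" "I \<noteq> {}"
  shows "card (linear_extensions R I)
    = (\<Sum>p \<in> minimal_elements R I. card (linear_extensions R (I - {p})))"
proof -
  have "linear_extensions R I
      = (\<Union>p \<in> minimal_elements R I. (#) p ` linear_extensions R (I - {p}))" (is "?L = ?R")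
  proof
    show "?L \<subseteq> ?R"
    proof
      fix qs assume qs: "qs \<in> ?L"
      then obtain p ps where "qs = p # ps"
        using assms(2) by (cases qs) (auto simp: linear_extensions_def)
      then show "qs \<in> ?R"
        using qs by (auto simp: linear_extensions_def minimal_elements_def)
    qed
    show "?R \<subseteq> ?L" by (auto simp: linear_extensions_def minimal_elements_def)
  qed
  moreover have "finite (minimal_elements R I)"
    using assms(1) by (simp add: minimal_elements_def)
  moreover have "card (\<Union>p \<in> minimal_elements R I. (#) p ` linear_extensions R (I - {p}))
      = (\<Sum>p \<in> minimal_elements R I. card ((#) p ` linear_extensions R (I - {p})))"
    using finite_linear_extensions[of "I - {_}" R] assms(1) calculation(2)
    by (intro card_UN_disjoint) auto
  ultimately show ?thesis by (simp add: card_image)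
qed

section \<open>The volume of an order polytope\<close>

text \<open>
  The box is open so that fixing the smallest coordinate to be \<open>y\<close> leaves exactly an order polytope
  over \<open>(y,b)\<close>, without an exceptional null set.
\<close>

definition open_order_polytope ::
  "('i \<times> 'i) set \<Rightarrow> 'i set \<Rightarrow> real \<Rightarrow> real \<Rightarrow> ('i \<Rightarrow> real) set" where
  "open_order_polytope R I a b =
     {x \<in> I \<rightarrow>\<^sub>E {a<..<b}. \<forall>i \<in> I. \<forall>j \<in> I. (i, j) \<in> R \<longrightarrow> x i < x j}"

lemma sets_open_order_polytope:
  assumes "finite I"
  shows "open_order_polytope R I a b \<in> sets (\<Pi>\<^sub>M i\<in>I. lborel)"
proof -
  let ?M = "\<Pi>\<^sub>M i\<in>I. (lborel :: real measure)"
  have [measurable]: "(\<lambda>x. x i) \<in> borel_measurable ?M" if "i \<in> I" for i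
    using measurable_component_singleton[OF that, of "\<lambda>_. lborel"] by simp
  have "open_order_polytope R I a b = {x \<in> space ?M. (\<forall>i \<in> I. a < x i \<and> x i < b) \<and>
      (\<forall>i \<in> I. \<forall>j \<in> I. (i, j) \<in> R \<longrightarrow> x i < x j)}"
    by (auto simp: open_order_polytope_def space_PiM PiE_iff)
  also have "\<dots> \<in> sets ?M"
    using assms by (intro sets.sets_Collect sets.sets_Collect_finite_All borel_measurable_less) auto
  finally show ?thesis .
qed

text \<open>
  By Fubini, integrating over coordinate \<open>i\<close> first: once the other coordinates are fixed, \<open>g\<close> is a
  constant, which is a single point of the line. The cases needed are \<open>g x = x j\<close> (no two coordinates
  agree) and \<open>g x = 0\<close>.
\<close>

lemma AE_PiM_lborel_coordinate_neq:
  fixes g :: "('i \<Rightarrow> real) \<Rightarrow> real"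
  assumes "finite I" "i \<in> I"
    and g: "g \<in> borel_measurable (\<Pi>\<^sub>M j\<in>I. lborel)"
    and indep: "\<And>x y. g (x(i := y)) = g x"
  shows "AE x in (\<Pi>\<^sub>M j\<in>I. lborel). x i \<noteq> g x"
proof -
  interpret product_sigma_finite "\<lambda>_. lborel :: real measure" by standard
  let ?M = "\<Pi>\<^sub>M j\<in>I. (lborel :: real measure)"
  let ?N = "{x \<in> space ?M. x i = g x}"
  have [measurable]: "(\<lambda>x. x i) \<in> borel_measurable ?M"
    using measurable_component_singleton[OF assms(2), of "\<lambda>_. lborel"] by simp
  note [measurable] = g
  have N[measurable]: "?N \<in> sets ?M" by measurable
  have I: "I = insert i (I - {i})" using assms(2) by blast
  have "emeasure ?M ?N = (\<integral>\<^sup>+ x. indicator ?N x \<partial>?M)"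
    by (simp add: N)
  also have "\<dots> = (\<integral>\<^sup>+ x. \<integral>\<^sup>+ y. indicator ?N (x(i := y)) \<partial>lborel \<partial>(\<Pi>\<^sub>M j\<in>I - {i}. lborel))"
    using product_nn_integral_insert[of "I - {i}" i "indicator ?N"] N assms(1) I by simp
  also have "\<dots> = (\<integral>\<^sup>+ x. 0 \<partial>(\<Pi>\<^sub>M j\<in>I - {i}. (lborel :: real measure)))"
  proof (rule nn_integral_cong)
    fix x :: "'i \<Rightarrow> real"
    have "(\<integral>\<^sup>+ y. indicator ?N (x(i := y)) \<partial>lborel) \<le> (\<integral>\<^sup>+ y. indicator {g x} y \<partial>lborel)"
      by (rule nn_integral_mono) (auto simp: indep indicator_def)
    then show "(\<integral>\<^sup>+ y. indicator ?N (x(i := y)) \<partial>lborel) = 0" by simp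
  qed
  finally have "emeasure ?M ?N = 0" by simp
  then show ?thesis by (intro AE_I[of _ _ ?N]) (use N in auto)
qed

lemma nn_integral_power_diff:
  fixes a b c :: real
  assumes "a \<le> b" "0 \<le> c"
  shows "(\<integral>\<^sup>+ y. ennreal (c * (b - y) ^ n) * indicator {a<..<b} y \<partial>lborel)
    = ennreal (c * (b - a) ^ Suc n / Suc n)"
proof -
  have "(\<integral>\<^sup>+ y. ennreal (c * (b - y) ^ n) * indicator {a<..<b} y \<partial>lborel)
      = (\<integral>\<^sup>+ y. ennreal (c * (b - y) ^ n) * indicator {a..b} y \<partial>lborel)"
    using AE_lborel_singleton[of a] AE_lborel_singleton[of b]
    by (intro nn_integral_cong_AE) (auto simp: indicator_def)
  also have "\<dots> = ennreal (- (c * (b - b) ^ Suc n / Suc n) - - (c * (b - a) ^ Suc n / Suc n))"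
  proof (rule nn_integral_FTC_Icc)
    fix y assume y: "y \<in> {a..b}"
    show "((\<lambda>y. - (c * (b - y) ^ Suc n / Suc n)) has_real_derivative c * (b - y) ^ n) (at y)"
      by (auto intro!: derivative_eq_intros simp del: power_Suc of_nat_Suc)
    show "0 \<le> c * (b - y) ^ n" using assms y by simp
  qed (use assms in auto)
  finally show ?thesis by simp
qed

text \<open>
  Induction on the number of coordinates. The lower endpoint has to be general, because removing the
  smallest coordinate \<open>y\<close> raises it from \<open>a\<close> to \<open>y\<close>.
\<close>

lemma emeasure_open_order_polytope:
  assumes "finite I" "a \<le> b"
  shows "emeasure (\<Pi>\<^sub>M i\<in>I. lborel) (open_order_polytope R I a b)
    = ennreal (real (card (linear_extensions R I)) / fact (card I) * (b - a) ^ card I)"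
  using assms
proof (induction "card I" arbitrary: I a)
  case 0
  then have I: "I = {}" by simp
  have "open_order_polytope R I a b = {\<lambda>_. undefined}"
    by (auto simp: I open_order_polytope_def)
  then show ?case by (simp add: I linear_extensions_empty PiM_empty)
next
  case (Suc n)
  interpret product_sigma_finite "\<lambda>_. lborel :: real measure" by standard
  let ?M = "\<lambda>I. \<Pi>\<^sub>M i\<in>I. (lborel :: real measure)"
  let ?P = "open_order_polytope R I a b"
  \<comment> \<open>The piece on which \<open>p\<close> has the smallest coordinate; the pieces miss only points with ties.\<close>
  define Q where "Q p = {x \<in> ?P. \<forall>j \<in> I - {p}. x p < x j}" for p
  have fI: "finite I" and ne: "I \<noteq> {}" using Suc by auto
  note comp = measurable_component_singleton[of _ I "\<lambda>_. lborel :: real measure", simplified]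
  have setsQ: "Q p \<in> sets (?M I)" if "p \<in> I" for p
  proof -
    have "Q p = ?P \<inter> {x \<in> space (?M I). \<forall>j \<in> I - {p}. x p < x j}"
      by (auto simp: Q_def open_order_polytope_def space_PiM)
    then show ?thesis
      using sets_open_order_polytope[OF fI] fI comp that
      by (auto intro!: sets.Int sets.sets_Collect_finite_All borel_measurable_less)
  qed
  have disj: "disjoint_family_on Q I"
    unfolding disjoint_family_on_def Q_def using less_asym by blast
  have ties: "AE x in ?M I. \<forall>i \<in> I. \<forall>j \<in> I - {i}. x i \<noteq> x j"
    using fI comp by (intro AE_finite_allI AE_PiM_lborel_coordinate_neq) auto
  have cover: "AE x in ?M I. x \<in> ?P \<longleftrightarrow> x \<in> (\<Union>p \<in> I. Q p)"
    using ties
  proof eventually_elim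
    case (elim x)
    have "\<exists>p \<in> I. \<forall>j \<in> I - {p}. x p < x j"
    proof -
      have "Min (x ` I) \<in> x ` I" using fI ne by simp
      then obtain p where p: "p \<in> I" "x p = Min (x ` I)" by auto
      then have "x p < x j" if "j \<in> I - {p}" for j
        using elim fI that by (metis DiffD1 Min_le finite_imageI imageI order_le_less)
      then show ?thesis using p by blast
    qed
    then show ?case by (auto simp: Q_def)
  qed
  have slice: "emeasure (?M I) (Q p)
      = ennreal (real (card (linear_extensions R (I - {p}))) / fact (Suc n) * (b - a) ^ Suc n)"
    if p: "p \<in> minimal_elements R I" for p
  proof -
    have pI: "p \<in> I" using p by (simp add: minimal_elements_def)
    then have I: "I = insert p (I - {p})" by blast
    have card': "card (I - {p}) = n" using Suc.hyps(2) pI by simp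
    let ?c = "real (card (linear_extensions R (I - {p}))) / fact n"
    \<comment> \<open>The constraints on \<open>p\<close> hold because \<open>p\<close> is minimal and \<open>y\<close> is the smallest value.\<close>
    have mem: "x(p := y) \<in> Q p \<longleftrightarrow> y \<in> {a<..<b} \<and> x \<in> open_order_polytope R (I - {p}) y b"
      if x: "x \<in> space (?M (I - {p}))" for x y
    proof -
      have minp: "(i, p) \<notin> R" if "i \<in> I" for i
        using p that by (auto simp: minimal_elements_def)
      have "x(p := y) \<in> I \<rightarrow>\<^sub>E {a<..<b} \<longleftrightarrow> y \<in> {a<..<b} \<and> (\<forall>i \<in> I - {p}. x i \<in> {a<..<b})"
        using x pI by (auto simp: space_PiM PiE_iff extensional_def)
      moreover have "x \<in> I - {p} \<rightarrow>\<^sub>E {y<..<b} \<longleftrightarrow> (\<forall>i \<in> I - {p}. x i \<in> {y<..<b})"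
        using x by (auto simp: space_PiM PiE_iff)
      moreover have "(\<forall>j \<in> I - {p}. (x(p := y)) p < (x(p := y)) j) \<longleftrightarrow> (\<forall>j \<in> I - {p}. y < x j)"
        by simp
      moreover have "(\<forall>i \<in> I. \<forall>j \<in> I. (i, j) \<in> R \<longrightarrow> (x(p := y)) i < (x(p := y)) j) \<longleftrightarrow>
          (\<forall>i \<in> I - {p}. \<forall>j \<in> I - {p}. (i, j) \<in> R \<longrightarrow> x i < x j)"
        if above: "\<forall>j \<in> I - {p}. y < x j"
      proof (intro iffI ballI impI)
        fix i j assume "\<forall>i \<in> I. \<forall>j \<in> I. (i, j) \<in> R \<longrightarrow> (x(p := y)) i < (x(p := y)) j"
          and ij: "i \<in> I - {p}" "j \<in> I - {p}" "(i, j) \<in> R"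
        then have "(x(p := y)) i < (x(p := y)) j" by blast
        then show "x i < x j" using ij by simp
      next
        fix i j assume rest: "\<forall>i \<in> I - {p}. \<forall>j \<in> I - {p}. (i, j) \<in> R \<longrightarrow> x i < x j"
          and ij: "i \<in> I" "j \<in> I" "(i, j) \<in> R"
        have "j \<noteq> p" using minp ij by blast
        then show "(x(p := y)) i < (x(p := y)) j"
          using rest above ij by (cases "i = p") auto
      qed
      moreover have "(\<forall>j \<in> I - {p}. x j \<in> {y<..<b}) \<longleftrightarrow>
          (\<forall>j \<in> I - {p}. x j \<in> {a<..<b}) \<and> (\<forall>j \<in> I - {p}. y < x j)" if "y \<in> {a<..<b}"
        using that by (auto intro: less_trans[of a y])
      ultimately show ?thesis
        unfolding Q_def open_order_polytope_def mem_Collect_eq by argo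
    qed
    have "emeasure (?M I) (Q p) = (\<integral>\<^sup>+ x. indicator (Q p) x \<partial>?M I)"
      using setsQ[OF pI] by simp
    also have "\<dots> = (\<integral>\<^sup>+ y. \<integral>\<^sup>+ x. indicator (Q p) (x(p := y)) \<partial>?M (I - {p}) \<partial>lborel)"
      using product_nn_integral_insert_rev[of "I - {p}" p "indicator (Q p)"] setsQ[OF pI] fI I
      by simp
    also have "\<dots> = (\<integral>\<^sup>+ y. ennreal (?c * (b - y) ^ n) * indicator {a<..<b} y \<partial>lborel)"
    proof (rule nn_integral_cong)
      fix y
      have "(\<integral>\<^sup>+ x. indicator (Q p) (x(p := y)) \<partial>?M (I - {p}))
          = (\<integral>\<^sup>+ x. indicator (open_order_polytope R (I - {p}) y b) x * indicator {a<..<b} y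
              \<partial>?M (I - {p}))"
        using mem by (intro nn_integral_cong) (auto simp: indicator_def)
      also have "\<dots> = emeasure (?M (I - {p})) (open_order_polytope R (I - {p}) y b)
          * indicator {a<..<b} y"
        using sets_open_order_polytope[of "I - {p}" R y b] fI by (subst nn_integral_multc) auto
      also have "\<dots> = ennreal (?c * (b - y) ^ n) * indicator {a<..<b} y"
        using Suc.hyps(1)[of "I - {p}" y] card' fI by (auto simp: indicator_def)
      finally show "(\<integral>\<^sup>+ x. indicator (Q p) (x(p := y)) \<partial>?M (I - {p}))
          = ennreal (?c * (b - y) ^ n) * indicator {a<..<b} y" .
    qed
    also have "\<dots> = ennreal (?c * (b - a) ^ Suc n / Suc n)"
      using Suc.prems by (intro nn_integral_power_diff) auto
    also have "?c * (b - a) ^ Suc n / Suc n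
        = real (card (linear_extensions R (I - {p}))) / fact (Suc n) * (b - a) ^ Suc n"
      by (simp add: mult.commute del: of_nat_Suc)
    finally show ?thesis .
  qed
  \<comment> \<open>Something must stay below a \<open>p\<close> that is not minimal, so it cannot have the smallest coordinate.\<close>
  have null: "Q p = {}" if "p \<in> I - minimal_elements R I" for p
  proof -
    obtain i where i: "i \<in> I" "(i, p) \<in> R" using \<open>p \<in> I - _\<close> by (auto simp: minimal_elements_def)
    have False if "x \<in> Q p" for x
    proof -
      have "x i < x p" and "i \<noteq> p \<longrightarrow> x p < x i"
        using that i \<open>p \<in> I - _\<close> by (auto simp: Q_def open_order_polytope_def)
      then show False by (cases "i = p") auto
    qed
    then show ?thesis by blast
  qed
  have "emeasure (?M I) ?P = emeasure (?M I) (\<Union>p \<in> I. Q p)"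
    using cover sets_open_order_polytope[OF fI] setsQ fI
    by (intro emeasure_eq_AE) auto
  also have "\<dots> = (\<Sum>p \<in> I. emeasure (?M I) (Q p))"
    using setsQ disj fI by (intro sum_emeasure[symmetric]) auto
  also have "\<dots> = (\<Sum>p \<in> minimal_elements R I. emeasure (?M I) (Q p))"
    using fI null by (intro sum.mono_neutral_right) (auto simp: minimal_elements_def)
  also have "\<dots> = (\<Sum>p \<in> minimal_elements R I.
      ennreal (real (card (linear_extensions R (I - {p}))) / fact (Suc n) * (b - a) ^ Suc n))"
    using slice by simp
  also have "\<dots> = ennreal (\<Sum>p \<in> minimal_elements R I.
      real (card (linear_extensions R (I - {p}))) / fact (Suc n) * (b - a) ^ Suc n)"
    using Suc.prems by (intro sum_ennreal) auto
  also have "(\<Sum>p \<in> minimal_elements R I.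
      real (card (linear_extensions R (I - {p}))) / fact (Suc n) * (b - a) ^ Suc n)
      = real (card (linear_extensions R I)) / fact (Suc n) * (b - a) ^ Suc n"
    by (simp only: card_linear_extensions_rec[OF fI ne] of_nat_sum
        sum_distrib_right[symmetric] sum_divide_distrib[symmetric])
  finally show ?case by (simp only: Suc.hyps(2))
qed

section \<open>The order of the integration variables\<close>

text \<open>
  Edges into the root are left out: they bound single variables by \<open>t\<close> and do not compare two of them.
\<close>

definition var_order :: "tree_rep \<Rightarrow> (nat set \<times> nat set) set" where
  "var_order t = {(var_of t u, var_of t v) | u v. (u, v) \<in> edges t \<and> v \<noteq> root t}"

lemma var_of_class:
  assumes "exotic_tree_rep t" "p \<in> int_vars t" "v \<in> p"
  shows "var_of t v = p"
proof (cases "p \<in> pairs t")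
  case True
  have "{q \<in> pairs t. v \<in> q} = {p}"
    using True assms(3) disjointD[OF exotic_tree_repD(7)[OF assms(1)]] by blast
  then show ?thesis unfolding var_of_def using assms(3) by (simp add: insert_absorb)
next
  case False
  then have "p = {v}" "v \<in> alpha_verts t"
    using assms int_vars_eq[OF assms(1)] by auto
  then have "v \<notin> q" if "q \<in> pairs t" for q
    using exotic_tree_repD(9)[OF assms(1) that] by (auto simp: colour_verts_def)
  then have none: "{q \<in> pairs t. v \<in> q} = {}" by blast
  then show ?thesis using \<open>p = {v}\<close> by (simp add: var_of_def none)
qed

lemma int_vars_non_root:
  assumes "exotic_tree_rep t" "p \<in> int_vars t"
  shows "p \<subseteq> verts t - {root t}"
  using assms exotic_tree_repD(10)[OF assms(1)] unfolding int_vars_eq[OF assms(1)]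
  by (auto simp: colour_verts_def)

text \<open>
  An edge into any vertex of the class \<open>p\<close> makes its source smaller than \<open>p\<close>. In particular a pair is
  minimal only if both its vertices are leaves, which is the condition in the definition of
  \<open>m_beta\<close>; both kinds of removal in the tree factorial thus become one.
\<close>

lemma minimal_elements_var_order:
  assumes t: "exotic_tree_rep t"
  shows "minimal_elements (var_order t) (int_vars t) = {p \<in> int_vars t. \<forall>v \<in> p. leaf t v}"
proof -
  have "(\<forall>i \<in> int_vars t. (i, p) \<notin> var_order t) \<longleftrightarrow> (\<forall>v \<in> p. leaf t v)"
    if p: "p \<in> int_vars t" for p
  proof
    assume L: "\<forall>i \<in> int_vars t. (i, p) \<notin> var_order t"
    show "\<forall>v \<in> p. leaf t v"
    proof
      fix v assume v: "v \<in> p"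
      have "False" if uv: "(u, v) \<in> edges t" for u
      proof -
        have "(var_of t u, p) \<in> var_order t"
          using uv var_of_class[OF t p v] int_vars_non_root[OF t p] v
          by (force simp: var_order_def)
        moreover have "var_of t u \<in> int_vars t"
          using edge_tail_non_root[OF t uv] by (auto simp: int_vars_def)
        ultimately show False using L by blast
      qed
      then show "leaf t v" using int_vars_non_root[OF t p] v by (auto simp: leaf_def)
    qed
  next
    assume R: "\<forall>v \<in> p. leaf t v"
    show "\<forall>i \<in> int_vars t. (i, p) \<notin> var_order t"
      using R unfolding var_order_def leaf_def by (auto simp: var_of_def)
  qed
  then show ?thesis by (auto simp: minimal_elements_def)
qed

lemma var_of_remove_verts:
  assumes "exotic_tree_rep t" "p \<in> int_vars t" "v \<notin> p"
  shows "var_of (remove_verts p t) v = var_of t v"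
proof -
  have "q \<inter> p = {}" if "q \<in> pairs t" "v \<in> q" for q
  proof -
    have "q \<in> int_vars t" using that int_vars_eq[OF assms(1)] by blast
    then show ?thesis using var_of_class[OF assms(1)] assms(2,3) that(2) by blast
  qed
  then have "{q \<in> pairs t. q \<inter> p = {} \<and> v \<in> q} = {q \<in> pairs t. v \<in> q}" by blast
  then show ?thesis by (simp add: var_of_def remove_verts_def)
qed

lemma var_of_eq_iff:
  assumes "exotic_tree_rep t" "p \<in> int_vars t"
  shows "var_of t v = p \<longleftrightarrow> v \<in> p"
  using var_of_class[OF assms] by (auto simp: var_of_def)

lemma int_vars_remove_verts:
  assumes t: "exotic_tree_rep t" and p: "p \<in> int_vars t"
  shows "int_vars (remove_verts p t) = int_vars t - {p}"
proof -
  have "int_vars (remove_verts p t) = var_of (remove_verts p t) ` (verts t - {root t} - p)"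
    by (simp add: int_vars_def remove_verts_def set_diff_eq conj_commute conj_left_commute)
  also have "\<dots> = var_of t ` (verts t - {root t} - p)"
    using var_of_remove_verts[OF t p] by (intro image_cong) auto
  also have "\<dots> = int_vars t - {p}"
    using var_of_eq_iff[OF t p] by (auto simp: int_vars_def)
  finally show ?thesis .
qed

text \<open>
  Removing the vertices of \<open>p\<close> deletes just those edges that would relate something to \<open>p\<close>, so the
  tree that is left induces on the remaining variables the restriction of the old relation.
\<close>

lemma linear_extensions_remove_verts:
  assumes t: "exotic_tree_rep t" and p: "p \<in> int_vars t"
  shows "linear_extensions (var_order (remove_verts p t)) (int_vars (remove_verts p t))
    = linear_extensions (var_order t) (int_vars t - {p})"
  unfolding int_vars_remove_verts[OF assms]
proof (rule linear_extensions_cong)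
  let ?J = "int_vars t - {p}" and ?s = "remove_verts p t"
  note rem = var_of_remove_verts[OF t p] and eq = var_of_eq_iff[OF t p]
  have s: "root ?s = root t" "\<And>u v. (u, v) \<in> edges ?s \<longleftrightarrow> (u, v) \<in> edges t \<and> u \<notin> p \<and> v \<notin> p"
    using exotic_tree_repD(3)[OF t] by (auto simp: remove_verts_def)
  show "var_order ?s \<inter> ?J \<times> ?J = var_order t \<inter> ?J \<times> ?J"
  proof (intro equalityI subsetI)
    fix ij assume "ij \<in> var_order ?s \<inter> ?J \<times> ?J"
    then obtain u v where "(u, v) \<in> edges ?s" "v \<noteq> root t" "ij = (var_of ?s u, var_of ?s v)"
      "ij \<in> ?J \<times> ?J" by (auto simp: var_order_def s(1))
    then show "ij \<in> var_order t \<inter> ?J \<times> ?J"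
      using rem s(2) by (auto simp: var_order_def)
  next
    fix ij assume "ij \<in> var_order t \<inter> ?J \<times> ?J"
    then obtain u v where uv: "(u, v) \<in> edges t" "v \<noteq> root t" "ij = (var_of t u, var_of t v)"
      and J: "ij \<in> ?J \<times> ?J" by (auto simp: var_order_def)
    then have "u \<notin> p" "v \<notin> p" using eq[of u] eq[of v] by auto
    then have "(u, v) \<in> edges ?s" "ij = (var_of ?s u, var_of ?s v)"
      using uv rem s(2) by auto
    then have "ij \<in> var_order ?s" using uv(2) s(1) unfolding var_order_def by auto
    then show "ij \<in> var_order ?s \<inter> ?J \<times> ?J" using J by blast
  qed
qed

section \<open>The tree factorial\<close>

lemma card_int_vars:
  assumes t: "exotic_tree_rep t"
  shows "card (int_vars t) = card (alpha_verts t) + card (beta_verts t) div 2"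
proof -
  have fin: "finite (alpha_verts t)" "finite (beta_verts t)"
    using exotic_tree_repD(1)[OF t] by (auto simp: colour_verts_def)
  have finp: "finite (pairs t)"
    using exotic_tree_repD(6)[OF t] fin(2) by (metis finite_UnionD)
  have "(\<lambda>v. {v}) ` alpha_verts t \<inter> pairs t = {}"
    using exotic_tree_repD(8)[OF t] by fastforce
  then have "card (int_vars t) = card (alpha_verts t) + card (pairs t)"
    using fin finp by (simp add: int_vars_eq[OF t] card_Un_disjoint card_image)
  moreover have "finite q" if "q \<in> pairs t" for q
    using exotic_tree_repD(8)[OF t that] by (metis card.infinite zero_neq_numeral)
  then have "card (beta_verts t) = 2 * card (pairs t)"
    using card_Union_disjoint[of "pairs t"] exotic_tree_repD(6-9)[OF t] fin(2)
    by (simp add: finite_subset pairwise_def disjoint_def disjnt_def)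
  ultimately show ?thesis by simp
qed

lemma exotic_equiv_refl: "exotic_tree_rep t \<Longrightarrow> exotic_equiv t t"
  using is_iso_id by (auto simp: exotic_equiv_def isomorphic_def)

lemma tree_size_abs:
  assumes "exotic_tree_rep t"
  shows "tree_size (abs_exotic_tree t) = card (int_vars t) + 1"
  using tree_size.abs_eq[OF exotic_equiv_refl[OF assms]] card_int_vars[OF assms] by simp

text \<open>
  With this the sets counted by \<open>m_alpha\<close> and \<open>m_beta\<close> become fibres of the map sending a removable
  class to the isomorphism class of the tree that is left.
\<close>

lemma exotic_equiv_rep_iff:
  assumes "exotic_tree_rep s"
  shows "exotic_equiv (rep_exotic_tree \<sigma>) s \<longleftrightarrow> abs_exotic_tree s = \<sigma>"
  using exotic_equiv_refl[OF assms] Quotient_rel[OF Quotient_exotic_tree, of "rep_exotic_tree \<sigma>" s]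
    rep_exotic_tree_equiv[of \<sigma>] Quotient_abs_rep[OF Quotient_exotic_tree, of \<sigma>]
  by auto

lemma exotic_tree_rep_remove_class:
  assumes t: "exotic_tree_rep t" and p: "p \<in> int_vars t" "\<forall>v \<in> p. leaf t v"
  shows "exotic_tree_rep (remove_verts p t)"
proof (rule exotic_tree_rep_remove_verts[OF t p(2)])
  fix q assume "q \<in> pairs t"
  then have "q \<in> int_vars t" using int_vars_eq[OF t] by blast
  then show "q \<inter> p = {} \<or> q \<subseteq> p" using var_of_class[OF t] p(1) by blast
qed

lemma m_alpha_abs:
  assumes t: "exotic_tree_rep t"
  shows "m_alpha \<sigma> (abs_exotic_tree t)
    = card {v \<in> {v \<in> alpha_verts t. leaf t v}. abs_exotic_tree (remove_verts {v} t) = \<sigma>}"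
proof -
  have "exotic_tree_rep (remove_verts {v} t)" if "v \<in> alpha_verts t" "leaf t v" for v
    using that by (intro exotic_tree_rep_remove_class[OF t]) (auto simp: int_vars_eq[OF t])
  then have "{v \<in> alpha_verts t. leaf t v \<and> exotic_equiv (rep_exotic_tree \<sigma>) (remove_verts {v} t)}
      = {v \<in> {v \<in> alpha_verts t. leaf t v}. abs_exotic_tree (remove_verts {v} t) = \<sigma>}"
    using exotic_equiv_rep_iff by auto
  then show ?thesis
    using m_alpha.abs_eq[OF rep_exotic_tree_equiv[of \<sigma>] exotic_equiv_refl[OF t]]
      Quotient_abs_rep[OF Quotient_exotic_tree, of \<sigma>] by simp
qed

lemma m_beta_abs:
  assumes t: "exotic_tree_rep t"
  shows "m_beta \<sigma> (abs_exotic_tree t)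
    = card {p \<in> {p \<in> pairs t. \<forall>v \<in> p. leaf t v}. abs_exotic_tree (remove_verts p t) = \<sigma>}"
proof -
  have "exotic_tree_rep (remove_verts p t)" if "p \<in> pairs t" "\<forall>v \<in> p. leaf t v" for p
    using that by (intro exotic_tree_rep_remove_class[OF t]) (auto simp: int_vars_eq[OF t])
  then have "{p \<in> pairs t. (\<forall>v \<in> p. leaf t v) \<and> exotic_equiv (rep_exotic_tree \<sigma>) (remove_verts p t)}
      = {p \<in> {p \<in> pairs t. \<forall>v \<in> p. leaf t v}. abs_exotic_tree (remove_verts p t) = \<sigma>}"
    using exotic_equiv_rep_iff by auto
  then show ?thesis
    using m_beta.abs_eq[OF rep_exotic_tree_equiv[of \<sigma>] exotic_equiv_refl[OF t]]
      Quotient_abs_rep[OF Quotient_exotic_tree, of \<sigma>] by simp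
qed

lemma sum_fibre_cards:
  fixes g :: "'b \<Rightarrow> real"
  assumes "finite A" "\<And>y. m y = card {x \<in> A. h x = y}"
  shows "(\<Sum>y \<in> {y. m y \<noteq> 0}. real (m y) * g y) = (\<Sum>x \<in> A. g (h x))"
proof -
  have "{y. m y \<noteq> 0} = h ` A" using assms by (auto simp: card_eq_0_iff)
  then have "(\<Sum>y \<in> {y. m y \<noteq> 0}. real (m y) * g y) = (\<Sum>y \<in> h ` A. \<Sum>x \<in> {x \<in> A. h x = y}. g (h x))"
    using assms(2) by simp
  then show ?thesis using sum.image_gen[OF assms(1), of "\<lambda>x. g (h x)" h] by simp
qed

text \<open>
  The recursion groups the removals by the isomorphism class that they yield, with multiplicity.
  Undoing the grouping gives a sum over the removable leaves and pairs of one fixed representative.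
\<close>

lemma inv_tree_factorial_rec:
  assumes t: "exotic_tree_rep t" and nb: "abs_exotic_tree t \<noteq> bullet"
  shows "real (tree_size (abs_exotic_tree t)) * inv_tree_factorial (abs_exotic_tree t)
    = (\<Sum>p \<in> minimal_elements (var_order t) (int_vars t).
        inv_tree_factorial (abs_exotic_tree (remove_verts p t)))"
proof -
  let ?g = "\<lambda>p. inv_tree_factorial (abs_exotic_tree (remove_verts p t))"
  let ?A = "{v \<in> alpha_verts t. leaf t v}" and ?B = "{p \<in> pairs t. \<forall>v \<in> p. leaf t v}"
  have "(\<lambda>v. {v}) ` ?A \<union> ?B = minimal_elements (var_order t) (int_vars t)"
    by (subst minimal_elements_var_order[OF t]) (auto simp: int_vars_eq[OF t])
  moreover have fin: "finite ?A" "finite ?B"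
    using finite_int_vars[OF t] exotic_tree_repD(1)[OF t]
    unfolding int_vars_eq[OF t] by (auto simp: colour_verts_def)
  moreover have "(\<lambda>v. {v}) ` ?A \<inter> ?B = {}"
    using exotic_tree_repD(8)[OF t] by fastforce
  ultimately have "(\<Sum>p \<in> minimal_elements (var_order t) (int_vars t). ?g p)
      = (\<Sum>p \<in> (\<lambda>v. {v}) ` ?A. ?g p) + (\<Sum>p \<in> ?B. ?g p)"
    by (metis (no_types, lifting) finite_imageI sum.union_disjoint)
  also have "(\<Sum>p \<in> (\<lambda>v. {v}) ` ?A. ?g p) = (\<Sum>v \<in> ?A. ?g {v})"
    by (simp add: sum.reindex)
  finally show ?thesis
    using nb tree_size_abs[OF t]
      sum_fibre_cards[OF fin(1) m_alpha_abs[OF t], of inv_tree_factorial]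
      sum_fibre_cards[OF fin(2) m_beta_abs[OF t], of inv_tree_factorial]
    by (subst inv_tree_factorial.simps) simp
qed

text \<open>
  Removing a minimal class lowers the size from \<open>n + 1\<close> to \<open>n\<close>. The induction hypothesis therefore
  gives each summand of \<open>inv_tree_factorial_rec\<close> as \<open>e'/((n - 1)! n) = e'/n!\<close>, and these summands add
  up by \<open>card_linear_extensions_rec\<close>.
\<close>

lemma inv_tree_factorial_eq_card_linear_extensions:
  assumes "exotic_tree_rep t"
  shows "real (tree_size (abs_exotic_tree t)) * inv_tree_factorial (abs_exotic_tree t)
    = real (card (linear_extensions (var_order t) (int_vars t))) / fact (card (int_vars t))"
  using assms
proof (induction "card (int_vars t)" arbitrary: t)
  case 0
  then have "abs_exotic_tree t = bullet"
    using tree_size_abs[OF 0(2)] tree_size_eq_1_iff by simp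
  then show ?case
    using 0 tree_size_eq_1_iff[of bullet] finite_int_vars[OF 0(2)]
    by (simp add: inv_tree_factorial.simps linear_extensions_empty)
next
  case (Suc n)
  let ?t = "abs_exotic_tree t" and ?R = "var_order t" and ?I = "int_vars t"
  note t = Suc.prems
  have "?t \<noteq> bullet"
    using tree_size_abs[OF t] tree_size_eq_1_iff[of ?t] Suc.hyps(2) by auto
  then have "real (tree_size ?t) * inv_tree_factorial ?t
      = (\<Sum>p \<in> minimal_elements ?R ?I. inv_tree_factorial (abs_exotic_tree (remove_verts p t)))"
    by (rule inv_tree_factorial_rec[OF t])
  also have "\<dots> = (\<Sum>p \<in> minimal_elements ?R ?I.
      real (card (linear_extensions ?R (?I - {p}))) / fact (Suc n))"
  proof (rule sum.cong[OF refl])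
    fix p assume "p \<in> minimal_elements ?R ?I"
    then have p: "p \<in> ?I" "\<forall>v \<in> p. leaf t v"
      unfolding minimal_elements_var_order[OF t] by auto
    let ?s = "remove_verts p t"
    have s: "exotic_tree_rep ?s" using exotic_tree_rep_remove_class[OF t p] .
    have c: "card (int_vars ?s) = n"
      using Suc.hyps(2) p(1) by (simp add: int_vars_remove_verts[OF t p(1)])
    have "real (Suc n) * inv_tree_factorial (abs_exotic_tree ?s)
        = real (card (linear_extensions ?R (?I - {p}))) / fact n"
      using Suc.hyps(1)[OF c[symmetric] s]
      unfolding tree_size_abs[OF s] c linear_extensions_remove_verts[OF t p(1)] by simp
    then have "inv_tree_factorial (abs_exotic_tree ?s)
        = real (card (linear_extensions ?R (?I - {p}))) / fact n / real (Suc n)"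
      by (simp add: nonzero_eq_divide_eq mult_ac del: of_nat_Suc)
    then show "inv_tree_factorial (abs_exotic_tree ?s)
        = real (card (linear_extensions ?R (?I - {p}))) / fact (Suc n)"
      by (simp add: mult.commute del: of_nat_Suc)
  qed
  also have "\<dots> = real (card (linear_extensions ?R ?I)) / fact (Suc n)"
  proof -
    have "finite ?I" "?I \<noteq> {}" using Suc.hyps(2) finite_int_vars[OF t] by auto
    then have "card (linear_extensions ?R ?I)
        = (\<Sum>p \<in> minimal_elements ?R ?I. card (linear_extensions ?R (?I - {p})))"
      by (rule card_linear_extensions_rec)
    then show ?thesis
      by (simp only: of_nat_sum sum_divide_distrib[symmetric])
  qed
  finally show ?case by (simp only: Suc.hyps(2))
qed

section \<open>The realization integral\<close>

lemma prod_of_bool: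
  assumes "finite A"
  shows "(\<Prod>x \<in> A. of_bool (P x) :: real) = of_bool (\<forall>x \<in> A. P x)"
  using assms by (induction A rule: finite_induct) auto

text \<open>
  The Heaviside factors at the root bound only its children by \<open>s\<close>; the bound reaches all the other
  variables by induction along the path to the root.
\<close>

lemma realization_integrand_eq_indicator:
  assumes t: "exotic_tree_rep t"
  shows "realization_integrand s t x = of_bool ((\<forall>i \<in> int_vars t. x i < s) \<and>
    (\<forall>i \<in> int_vars t. \<forall>j \<in> int_vars t. (i, j) \<in> var_order t \<longrightarrow> x i < x j))"
proof -
  let ?C = "\<lambda>u v. if v = root t then x (var_of t u) < s else x (var_of t u) < x (var_of t v)"
  have fin: "finite (edges t)"
    using exotic_tree_repD(1,3)[OF t] by (meson finite_SigmaI finite_subset)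
  have "realization_integrand s t x = (\<Prod>e \<in> edges t. of_bool (case e of (u, v) \<Rightarrow> ?C u v))"
    unfolding realization_integrand_def by (intro prod.cong) (auto simp: heaviside_def split: if_splits)
  also have "\<dots> = of_bool (\<forall>(u, v) \<in> edges t. ?C u v)"
    using fin by (rule prod_of_bool)
  also have "(\<forall>(u, v) \<in> edges t. ?C u v) \<longleftrightarrow> (\<forall>i \<in> int_vars t. x i < s) \<and>
    (\<forall>i \<in> int_vars t. \<forall>j \<in> int_vars t. (i, j) \<in> var_order t \<longrightarrow> x i < x j)"
    (is "?L \<longleftrightarrow> ?R")
  proof
    assume L: ?L
    have "u \<noteq> root t \<longrightarrow> x (var_of t u) < s" if "(u, root t) \<in> (edges t)\<^sup>*" for u
      using that
    proof (induction rule: converse_rtrancl_induct)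
      case (step y z)
      then show ?case using L by (force split: if_splits)
    qed simp
    then have "\<forall>i \<in> int_vars t. x i < s"
      using exotic_tree_repD(5)[OF t] by (auto simp: int_vars_def)
    then show ?R using L by (auto simp: var_order_def split: if_splits)
  next
    assume R: ?R
    have var: "var_of t u \<in> int_vars t" if "u \<in> verts t - {root t}" for u
      using that by (auto simp: int_vars_def)
    have "?C u v" if uv: "(u, v) \<in> edges t" for u v
    proof (cases "v = root t")
      case True
      then show ?thesis using R var edge_tail_non_root[OF t uv] by simp
    next
      case False
      then have "(var_of t u, var_of t v) \<in> var_order t"
        using uv by (auto simp: var_order_def)
      then show ?thesis using False R var edge_tail_non_root[OF t uv] by simp
    qed
    then show ?L by blast
  qed
  finally show ?thesis .
qed

text \<open>
  On \<open>[0,T]\<close> the integrand is the indicator of the order polytope in \<open>(0,s)\<close> except where some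
  coordinate is 0. The assumption \<open>s \<le> T\<close> ensures that the upper limit \<open>T\<close> cuts off nothing.
\<close>

lemma realization_integral_eq:
  assumes t: "exotic_tree_rep t" and s: "s \<in> {0..T}"
  shows "realization_integral T s t
    = real (card (linear_extensions (var_order t) (int_vars t))) / fact (card (int_vars t))
      * s ^ card (int_vars t)"
proof -
  let ?I = "int_vars t"
  let ?M = "\<Pi>\<^sub>M i\<in>?I. (lborel :: real measure)"
  let ?P = "open_order_polytope (var_order t) ?I 0 s"
  have fI: "finite ?I" using finite_int_vars[OF t] .
  have "AE x in ?M. \<forall>i \<in> ?I. x i \<noteq> 0"
    using fI by (intro AE_finite_allI AE_PiM_lborel_coordinate_neq) auto
  then have AE: "AE x in ?M. indicator (\<Pi>\<^sub>E i\<in>?I. {0..T}) x *\<^sub>R realization_integrand s t x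
      = indicator ?P x"
  proof (rule AE_mp, intro AE_I2 impI)
    fix x assume x: "x \<in> space ?M" and nz: "\<forall>i \<in> ?I. x i \<noteq> 0"
    have "x \<in> ?P \<longleftrightarrow> x \<in> (\<Pi>\<^sub>E i\<in>?I. {0..T}) \<and> (\<forall>i \<in> ?I. x i < s) \<and>
        (\<forall>i \<in> ?I. \<forall>j \<in> ?I. (i, j) \<in> var_order t \<longrightarrow> x i < x j)"
    proof -
      have "x \<in> ?I \<rightarrow>\<^sub>E {0<..<s} \<longleftrightarrow> (\<forall>i \<in> ?I. 0 < x i \<and> x i < s)"
        using x by (simp add: space_PiM PiE_iff)
      also have "\<dots> \<longleftrightarrow> (\<forall>i \<in> ?I. 0 \<le> x i \<and> x i \<le> T \<and> x i < s)"
      proof (rule ball_cong[OF refl])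
        fix i assume "i \<in> ?I"
        then have "x i \<noteq> 0" using nz by blast
        then show "0 < x i \<and> x i < s \<longleftrightarrow> 0 \<le> x i \<and> x i \<le> T \<and> x i < s" using s by auto
      qed
      also have "\<dots> \<longleftrightarrow> x \<in> (\<Pi>\<^sub>E i\<in>?I. {0..T}) \<and> (\<forall>i \<in> ?I. x i < s)"
        using x by (simp add: space_PiM PiE_iff ball_conj_distrib)
      finally show ?thesis unfolding open_order_polytope_def mem_Collect_eq by (simp only: conj_assoc)
    qed
    then show "indicator (\<Pi>\<^sub>E i\<in>?I. {0..T}) x *\<^sub>R realization_integrand s t x = indicator ?P x"
      by (simp add: realization_integrand_eq_indicator[OF t] indicator_def)
  qed
  have setsP: "?P \<in> sets ?M" using sets_open_order_polytope[OF fI] .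
  have "realization_integral T s t = (\<integral>x. indicator ?P x \<partial>?M)"
    unfolding realization_integral_def set_lebesgue_integral_def
    using realization_integrand_measurable[OF t] fI setsP AE
    by (intro integral_cong_AE borel_measurable_scaleR borel_measurable_indicator
        sets_PiM_I_finite) auto
  also have "\<dots> = measure ?M ?P" using sets.sets_into_space[OF setsP] by (simp add: Int_absorb2)
  also have "\<dots> = real (card (linear_extensions (var_order t) ?I)) / fact (card ?I) * s ^ card ?I"
    using emeasure_open_order_polytope[OF fI, of 0 s "var_order t"] s by (simp add: measure_def)
  finally show ?thesis .
qed

theorem proposition2p23:
  fixes T t :: real and \<tau> :: exotic_tree
  assumes "T > 0" and "t \<in> {0..T}"
  shows "exotic_realization T t \<tau>
    = real (tree_size \<tau>) * inv_tree_factorial \<tau> * t ^ (tree_size \<tau> - 1)"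
proof (cases "\<tau> = bullet")
  case True
  then show ?thesis
    using tree_size_eq_1_iff[of bullet]
    by (simp add: exotic_realization_def inv_tree_factorial.simps)
next
  case False
  define r where "r = rep_exotic_tree \<tau>"
  have r: "exotic_tree_rep r"
    using rep_exotic_tree_equiv unfolding r_def exotic_equiv_def by blast
  have \<tau>: "\<tau> = abs_exotic_tree r"
    using Quotient_abs_rep[OF Quotient_exotic_tree, of \<tau>] by (simp add: r_def)
  have "exotic_realization T t \<tau> = realization_integral T t r"
    using False by (simp add: exotic_realization_def realization_integral_class.rep_eq r_def)
  also have "\<dots> = real (tree_size \<tau>) * inv_tree_factorial \<tau> * t ^ card (int_vars r)"
    using realization_integral_eq[OF r assms(2)] inv_tree_factorial_eq_card_linear_extensions[OF r]
    by (simp add: \<tau>)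
  also have "card (int_vars r) = tree_size \<tau> - 1"
    using tree_size_abs[OF r] by (simp add: \<tau>)
  finally show ?thesis .
qed

end
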